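(* (1) $\mathsf{IQC}+\{\mathrm{CD},\mathrm{SW}\}\nvdash\mathrm{ED}$. (2) $\mathsf{IQC}+\{\mathrm{CD},\mathrm{ED}\}\nvdash\mathrm{SW}$. (3) $\mathsf{IQC}+\mathrm{SW}\vdash\mathrm{CD}$. (4) $\mathsf{IQC}+\mathrm{ED}\nvdash\mathrm{CD}$.
   Context: For a set of schemas, $\mathsf{IQC}+\{\dots\}$ is the smallest set of first-order formulas containing intuitionistic predicate logic and all instances of the schemas, closed under the rules of $\mathsf{IQC}$. "$L\vdash X$" for a schema $X$ means every instance of $X$ is derivable; "$L\nvdash X$" means some instance is not. Schemas (for formulas $A(x),B$ with $x$ not free in $B$): $\mathrm{CD}$: $\forall x(A(x)\vee B)\to\forall xA(x)\vee B$; $\mathrm{ED}$: $(B\to\exists xA(x))\to\exists x(B\to A(x))$; $\mathrm{SW}$: $(\forall xA(x)\to B)\to\exists x(A(x)\to B)$. *)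

theory Defs
  imports Main
begin

text \<open>
  Function and predicate symbols are determined by an index together with the length of the
  argument list, so there are countably many symbols of every arity; constants and propositional
  atoms are the case of the empty list. There is no equality, and \<open>\<not>A\<close> is \<open>A \<rightarrow> \<bottom>\<close>.
\<close>

datatype tm = Var nat | Fun nat "tm list"

datatype fm =
    Falsum
  | Pred nat "tm list"
  | Conj fm fm
  | Disj fm fm
  | Impl fm fm
  | All nat fm
  | Ex nat fm

fun tvars :: "tm \<Rightarrow> nat set" where
  "tvars (Var x) = {x}"
| "tvars (Fun f ts) = (\<Union>t \<in> set ts. tvars t)"

fun fv :: "fm \<Rightarrow> nat set" where
  "fv Falsum = {}"
| "fv (Pred p ts) = (\<Union>t \<in> set ts. tvars t)"
| "fv (Conj A B) = fv A \<union> fv B"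
| "fv (Disj A B) = fv A \<union> fv B"
| "fv (Impl A B) = fv A \<union> fv B"
| "fv (All x A) = fv A - {x}"
| "fv (Ex x A) = fv A - {x}"

fun tsubst :: "nat \<Rightarrow> tm \<Rightarrow> tm \<Rightarrow> tm" where
  "tsubst x s (Var y) = (if y = x then s else Var y)"
| "tsubst x s (Fun f ts) = Fun f (map (tsubst x s) ts)"

text \<open>
  \<open>subst x s A\<close> replaces the free occurrences of \<open>x\<close> in \<open>A\<close> by \<open>s\<close> without renaming bound
  variables; it is only used when \<open>s\<close> is free for \<open>x\<close> in \<open>A\<close>.
\<close>

fun subst :: "nat \<Rightarrow> tm \<Rightarrow> fm \<Rightarrow> fm" where
  "subst x s Falsum = Falsum"
| "subst x s (Pred p ts) = Pred p (map (tsubst x s) ts)"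
| "subst x s (Conj A B) = Conj (subst x s A) (subst x s B)"
| "subst x s (Disj A B) = Disj (subst x s A) (subst x s B)"
| "subst x s (Impl A B) = Impl (subst x s A) (subst x s B)"
| "subst x s (All y A) = (if y = x then All y A else All y (subst x s A))"
| "subst x s (Ex y A) = (if y = x then Ex y A else Ex y (subst x s A))"

fun free_for :: "tm \<Rightarrow> nat \<Rightarrow> fm \<Rightarrow> bool" where
  "free_for s x Falsum \<longleftrightarrow> True"
| "free_for s x (Pred p ts) \<longleftrightarrow> True"
| "free_for s x (Conj A B) \<longleftrightarrow> free_for s x A \<and> free_for s x B"
| "free_for s x (Disj A B) \<longleftrightarrow> free_for s x A \<and> free_for s x B"
| "free_for s x (Impl A B) \<longleftrightarrow> free_for s x A \<and> free_for s x B"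
| "free_for s x (All y A) \<longleftrightarrow> x \<notin> fv (All y A) \<or> (y \<notin> tvars s \<and> free_for s x A)"
| "free_for s x (Ex y A) \<longleftrightarrow> x \<notin> fv (Ex y A) \<or> (y \<notin> tvars s \<and> free_for s x A)"

inductive_set IQC_axioms :: "fm set" where
  ax_implK: "Impl A (Impl B A) \<in> IQC_axioms"
| ax_implS: "Impl (Impl A (Impl B C)) (Impl (Impl A B) (Impl A C)) \<in> IQC_axioms"
| ax_conjE1: "Impl (Conj A B) A \<in> IQC_axioms"
| ax_conjE2: "Impl (Conj A B) B \<in> IQC_axioms"
| ax_conjI: "Impl A (Impl B (Conj A B)) \<in> IQC_axioms"
| ax_disjI1: "Impl A (Disj A B) \<in> IQC_axioms"
| ax_disjI2: "Impl B (Disj A B) \<in> IQC_axioms"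
| ax_disjE: "Impl (Impl A C) (Impl (Impl B C) (Impl (Disj A B) C)) \<in> IQC_axioms"
| ax_falsumE: "Impl Falsum A \<in> IQC_axioms"
| ax_allE: "free_for s x A \<Longrightarrow> Impl (All x A) (subst x s A) \<in> IQC_axioms"
| ax_exI: "free_for s x A \<Longrightarrow> Impl (subst x s A) (Ex x A) \<in> IQC_axioms"

text \<open>
  \<open>IQC_plus X\<close> is the logic obtained from intuitionistic predicate logic by adding the
  formulas in \<open>X\<close> as axioms, under a Hilbert-style calculus; \<open>IQC_plus {}\<close> is
  intuitionistic predicate logic itself. A schema is represented by the set of its instances,
  so \<open>L \<turnstile> X\<close> for a schema \<open>X\<close> is \<open>X \<subseteq> L\<close>.
\<close>

inductive_set IQC_plus :: "fm set \<Rightarrow> fm set" for X :: "fm set" where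
  iqc_ax: "A \<in> IQC_axioms \<Longrightarrow> A \<in> IQC_plus X"
| iqc_inst: "A \<in> X \<Longrightarrow> A \<in> IQC_plus X"
| iqc_mp: "Impl A B \<in> IQC_plus X \<Longrightarrow> A \<in> IQC_plus X \<Longrightarrow> B \<in> IQC_plus X"
| iqc_allR: "Impl B A \<in> IQC_plus X \<Longrightarrow> x \<notin> fv B \<Longrightarrow> Impl B (All x A) \<in> IQC_plus X"
| iqc_exR: "Impl A B \<in> IQC_plus X \<Longrightarrow> x \<notin> fv B \<Longrightarrow> Impl (Ex x A) B \<in> IQC_plus X"

definition CD :: "fm set" where
  "CD = {Impl (All x (Disj A B)) (Disj (All x A) B) | x A B. x \<notin> fv B}"

definition ED :: "fm set" where
  "ED = {Impl (Impl B (Ex x A)) (Ex x (Impl B A)) | x A B. x \<notin> fv B}"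

definition SW :: "fm set" where
  "SW = {Impl (Impl (All x A) B) (Ex x (Impl A B)) | x A B. x \<notin> fv B}"

end

theory Submission
  imports Defs "HOL-Library.Extended_Nat"
begin

text \<open>
  The three underivability claims come from Kripke models on linear frames. With constant domains
  CD always holds; SW holds if every nonempty set of worlds has a last element, ED if every
  nonempty set of worlds has a first one. The frames \<open>(enat, \<ge>)\<close> and \<open>(nat, \<le>)\<close> separate the two.

  For ED without CD, take the worlds \<open>0, 1, 2, \<dots>\<close>, the domain \<open>{0}\<close> at world \<open>0\<close> and \<open>\<nat>\<close> at later
  worlds. Let \<open>P\<close> hold of \<open>a\<close> at \<open>w\<close> iff \<open>a \<le> w - 1\<close> (truncated subtraction, so \<open>P(0)\<close> holds at world \<open>0\<close>), and
  let \<open>Q\<close> hold from world \<open>1\<close> on. The model above world \<open>1\<close> looks like the model above \<open>1 + k\<close>, with \<open>a\<close> playing the role of \<open>a - k\<close>. So if \<open>A(a)\<close> is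
  forced at \<open>1\<close>, it is forced at \<open>1 + a\<close>, and shifting back, \<open>A(0)\<close> is forced at \<open>1\<close>: for ED, the
  only element of the root domain is as good a witness as any later one.

  To derive CD from SW, apply SW to the theorem \<open>\<forall>x A \<rightarrow> \<forall>x A \<or> B\<close>.
\<close>

section \<open>Kripke semantics\<close>

lemma subst_notin_fv: "x \<notin> fv A \<Longrightarrow> subst x s A = A"
proof -
  have "x \<notin> tvars t \<Longrightarrow> tsubst x s t = t" for t
    by (induction t) (auto intro: map_idI)
  then show "x \<notin> fv A \<Longrightarrow> subst x s A = A"
    by (induction A) (auto intro: map_idI)
qed

text \<open>Taken at the empty list, \<open>F_closed\<close> makes every domain nonempty.\<close>

locale kripke =
  fixes R :: "'w \<Rightarrow> 'w \<Rightarrow> bool"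
    and D :: "'w \<Rightarrow> 'a set"
    and F :: "nat \<Rightarrow> 'a list \<Rightarrow> 'a"
    and I :: "'w \<Rightarrow> nat \<Rightarrow> 'a list \<Rightarrow> bool"
  assumes R_refl: "R w w"
    and R_trans: "R u v \<Longrightarrow> R v w \<Longrightarrow> R u w"
    and D_mono: "R w v \<Longrightarrow> D w \<subseteq> D v"
    and F_closed: "set as \<subseteq> D w \<Longrightarrow> F f as \<in> D w"
    and I_mono: "R w v \<Longrightarrow> I w p as \<Longrightarrow> I v p as"
begin

fun eval :: "(nat \<Rightarrow> 'a) \<Rightarrow> tm \<Rightarrow> 'a" where
  "eval e (Var x) = e x"
| "eval e (Fun f ts) = F f (map (eval e) ts)"

fun force :: "'w \<Rightarrow> (nat \<Rightarrow> 'a) \<Rightarrow> fm \<Rightarrow> bool" where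
  "force w e Falsum \<longleftrightarrow> False"
| "force w e (Pred p ts) \<longleftrightarrow> I w p (map (eval e) ts)"
| "force w e (Conj A B) \<longleftrightarrow> force w e A \<and> force w e B"
| "force w e (Disj A B) \<longleftrightarrow> force w e A \<or> force w e B"
| "force w e (Impl A B) \<longleftrightarrow> (\<forall>v. R w v \<longrightarrow> force v e A \<longrightarrow> force v e B)"
| "force w e (All x A) \<longleftrightarrow> (\<forall>v. R w v \<longrightarrow> (\<forall>a\<in>D v. force v (e(x := a)) A))"
| "force w e (Ex x A) \<longleftrightarrow> (\<exists>a\<in>D w. force w (e(x := a)) A)"

definition valid :: "fm \<Rightarrow> bool" where
  "valid A \<longleftrightarrow> (\<forall>w e. range e \<subseteq> D w \<longrightarrow> force w e A)"

lemma validI: "(\<And>w e. range e \<subseteq> D w \<Longrightarrow> force w e A) \<Longrightarrow> valid A"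
  by (simp add: valid_def)

lemma validD: "valid A \<Longrightarrow> range e \<subseteq> D w \<Longrightarrow> force w e A"
  by (simp add: valid_def)

lemma range_mono: "range e \<subseteq> D w \<Longrightarrow> R w v \<Longrightarrow> range e \<subseteq> D v"
  using D_mono by blast

lemma range_upd: "range e \<subseteq> D w \<Longrightarrow> a \<in> D w \<Longrightarrow> range (e(x := a)) \<subseteq> D w"
  by auto

lemma force_mono: "R w v \<Longrightarrow> force w e A \<Longrightarrow> force v e A"
proof (induction A arbitrary: w v e)
  case (Pred p ts)
  then show ?case using I_mono by simp
next
  case (Impl A B)
  then show ?case using R_trans[OF Impl.prems(1)] by simp
next
  case (All x A)
  then show ?case using R_trans[OF All.prems(1)] by simp
next
  case (Ex x A)
  then show ?case using D_mono by fastforce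
qed auto

lemma eval_cong: "(\<And>x. x \<in> tvars t \<Longrightarrow> e x = e' x) \<Longrightarrow> eval e t = eval e' t"
proof (induction t)
  case (Fun f ts)
  then have "map (eval e) ts = map (eval e') ts"
    by fastforce
  then show ?case by (simp only: eval.simps)
qed simp

lemma force_cong: "(\<And>x. x \<in> fv A \<Longrightarrow> e x = e' x) \<Longrightarrow> force w e A \<longleftrightarrow> force w e' A"
proof (induction A arbitrary: w e e')
  case (Pred p ts)
  then have "map (eval e) ts = map (eval e') ts"
    by (auto intro!: eval_cong)
  then show ?case by (simp only: force.simps)
next
  case (Conj A B)
  then show ?case by (metis UnCI force.simps(3) fv.simps(3))
next
  case (Disj A B)
  then show ?case by (metis UnCI force.simps(4) fv.simps(4))
next
  case (Impl A B)
  have "force v e A = force v e' A" "force v e B = force v e' B" for v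
    by (rule Impl.IH(1), use Impl.prems in simp) (rule Impl.IH(2), use Impl.prems in simp)
  then show ?case by simp
next
  case (All x A)
  have "force v (e(x := a)) A = force v (e'(x := a)) A" for v a
    by (rule All.IH) (use All.prems in auto)
  then show ?case by simp
next
  case (Ex x A)
  have "force w (e(x := a)) A = force w (e'(x := a)) A" for a
    by (rule Ex.IH) (use Ex.prems in auto)
  then show ?case by simp
qed simp

lemma force_upd_notin_fv: "x \<notin> fv A \<Longrightarrow> force w (e(x := a)) A \<longleftrightarrow> force w e A"
  by (rule force_cong) auto

lemma eval_in_D: "range e \<subseteq> D w \<Longrightarrow> eval e t \<in> D w"
  by (induction t) (auto intro!: F_closed)

lemma eval_tsubst: "eval e (tsubst x s t) = eval (e(x := eval e s)) t"
  by (induction t) (auto intro!: arg_cong[where f = "F _"])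

lemma force_subst:
  "free_for s x A \<Longrightarrow> force w e (subst x s A) \<longleftrightarrow> force w (e(x := eval e s)) A"
proof (induction A arbitrary: w e)
  case (Pred p ts)
  then show ?case by (simp add: eval_tsubst comp_def del: fun_upd_apply)
next
  case (All y A)
  show ?case
  proof (cases "x \<in> fv (All y A)")
    case True
    then have yx: "y \<noteq> x" and ff: "y \<notin> tvars s" "free_for s x A"
      using All.prems by auto
    \<comment> \<open>Since \<open>y\<close> does not occur in \<open>s\<close>, the updates at
      \<open>x\<close> and \<open>y\<close> can be made in either order.\<close>
    have "eval (e(y := a)) s = eval e s" for a
      using ff by (intro eval_cong) auto
    then show ?thesis
      using yx ff by (simp add: All.IH fun_upd_twist del: fun_upd_apply)
  next
    case False
    then show ?thesis by (metis subst_notin_fv force_upd_notin_fv)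
  qed
next
  case (Ex y A)
  show ?case
  proof (cases "x \<in> fv (Ex y A)")
    case True
    then have yx: "y \<noteq> x" and ff: "y \<notin> tvars s" "free_for s x A"
      using Ex.prems by auto
    have "eval (e(y := a)) s = eval e s" for a
      using ff by (intro eval_cong) auto
    then show ?thesis
      using yx ff by (simp add: Ex.IH fun_upd_twist del: fun_upd_apply)
  next
    case False
    then show ?thesis by (metis subst_notin_fv force_upd_notin_fv)
  qed
qed auto

section \<open>Soundness of the calculus\<close>

lemma IQC_axioms_valid: "A \<in> IQC_axioms \<Longrightarrow> valid A"
proof (induction rule: IQC_axioms.induct)
  case (ax_implK A B)
  show ?case by (rule validI) (auto intro: force_mono)
next
  case (ax_implS A B C)
  show ?case by (rule validI) (simp, meson R_refl R_trans)
next
  case (ax_conjI A B)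
  show ?case by (rule validI) (auto intro: force_mono)
next
  case (ax_disjE A C B)
  show ?case by (rule validI) (simp, meson R_refl R_trans)
next
  case (ax_allE s x A)
  show ?case
  proof (rule validI)
    fix w and e :: "nat \<Rightarrow> 'a" assume e: "range e \<subseteq> D w"
    show "force w e (Impl (All x A) (subst x s A))"
      using eval_in_D[OF range_mono[OF e]] R_refl by (simp add: force_subst[OF ax_allE])
  qed
next
  case (ax_exI s x A)
  show ?case
  proof (rule validI)
    fix w and e :: "nat \<Rightarrow> 'a" assume e: "range e \<subseteq> D w"
    show "force w e (Impl (subst x s A) (Ex x A))"
      using eval_in_D[OF range_mono[OF e]] by (auto simp: force_subst[OF ax_exI])
  qed
qed (auto simp: valid_def)

theorem soundness:
  assumes X: "\<And>A. A \<in> X \<Longrightarrow> valid A" and "A \<in> IQC_plus X"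
  shows "valid A"
  using assms(2)
proof (induction rule: IQC_plus.induct)
  case (iqc_ax A)
  then show ?case by (rule IQC_axioms_valid)
next
  case (iqc_inst A)
  then show ?case by (rule X)
next
  case (iqc_mp A B)
  then show ?case using R_refl unfolding valid_def by auto
next
  case (iqc_allR B A x)
  show ?case
  proof (rule validI)
    fix w and e :: "nat \<Rightarrow> 'a" assume e: "range e \<subseteq> D w"
    show "force w e (Impl B (All x A))"
    proof (clarsimp)
      fix v u a assume "R w v" "force v e B" "R v u" "a \<in> D u"
      then have "force u (e(x := a)) B" "range (e(x := a)) \<subseteq> D u"
        using force_mono force_upd_notin_fv[OF iqc_allR.hyps(2)]
          range_upd[OF range_mono[OF e R_trans]] by blast+
      then show "force u (e(x := a)) A"
        using validD[OF iqc_allR.IH] R_refl by simp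
    qed
  qed
next
  case (iqc_exR A B x)
  show ?case
  proof (rule validI)
    fix w and e :: "nat \<Rightarrow> 'a" assume e: "range e \<subseteq> D w"
    show "force w e (Impl (Ex x A) B)"
    proof (clarsimp)
      fix v a assume "R w v" "a \<in> D v" "force v (e(x := a)) A"
      then have "force v (e(x := a)) B"
        using validD[OF iqc_exR.IH range_upd[OF range_mono[OF e]]] R_refl by simp
      then show "force v e B"
        using force_upd_notin_fv[OF iqc_exR.hyps(2)] by blast
    qed
  qed
qed

section \<open>Frame conditions for CD, SW and ED\<close>

lemma CD_valid:
  assumes const: "\<And>w v. R w v \<Longrightarrow> D v = D w" and "C \<in> CD"
  shows "valid C"
proof (rule validI)
  fix w and e :: "nat \<Rightarrow> 'a"
  obtain x A B where C: "C = Impl (All x (Disj A B)) (Disj (All x A) B)" and x: "x \<notin> fv B"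
    using assms(2) unfolding CD_def by blast
  show "force w e C"
    \<comment> \<open>Where B fails, the premise gives A for every element of the current domain; as
      no new elements appear later, monotonicity yields the universal formula.\<close>
    unfolding C using const force_mono R_refl
    by (simp add: force_upd_notin_fv[OF x]) metis
qed

text \<open>Without a witness, each \<open>a\<close> has a world above \<open>u\<close> forcing A(a)
  but not B. The last world above \<open>u\<close> that refutes B then forces every A(a), against
  the premise.\<close>

lemma SW_valid:
  assumes const: "\<And>w v. R w v \<Longrightarrow> D v = D w"
    and last: "\<And>S. S \<noteq> {} \<Longrightarrow> \<exists>m\<in>S. \<forall>v\<in>S. R v m"
    and "C \<in> SW"
  shows "valid C"
proof (rule validI)
  fix w and e :: "nat \<Rightarrow> 'a"
  obtain x A B where C: "C = Impl (Impl (All x A) B) (Ex x (Impl A B))" and x: "x \<notin> fv B"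
    using assms(3) unfolding SW_def by blast
  show "force w e C"
    unfolding C
  proof (subst force.simps, intro allI impI)
    fix u assume u: "force u e (Impl (All x A) B)"
    show "force u e (Ex x (Impl A B))"
    proof (rule ccontr)
      assume no: "\<not> force u e (Ex x (Impl A B))"
      define S where "S = {v. R u v \<and> \<not> force v e B}"
      have fail: "\<exists>v\<in>S. force v (e(x := a)) A" if "a \<in> D u" for a
        using no that by (auto simp: S_def force_upd_notin_fv[OF x])
      have "F 0 [] \<in> D u" by (rule F_closed) simp
      then have "S \<noteq> {}" using fail by blast
      then obtain m where m: "m \<in> S" "\<And>v. v \<in> S \<Longrightarrow> R v m"
        using last by meson
      have "force m (e(x := a)) A" if "a \<in> D u" for a
        using fail[OF that] m(2) force_mono by blast
      \<comment> \<open>Constancy of the domain leaves only elements of \<open>D u\<close> to check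
        above \<open>m\<close>.\<close>
      then have "force m e (All x A)"
        using const m(1) force_mono unfolding S_def by simp blast
      then show False
        using u m(1) unfolding S_def force.simps(5) by blast
    qed
  qed
qed

text \<open>A witness at the first world forcing B persists to all others; if B is never forced, any
  element will do. Constancy is asked only above \<open>w\<close>, so that the lemma also applies at
  the later worlds of a model whose domain grows at the root.\<close>

lemma force_ED:
  assumes const: "\<And>v. R w v \<Longrightarrow> D v = D w"
    and first: "\<And>S. S \<noteq> {} \<Longrightarrow> \<exists>m\<in>S. \<forall>v\<in>S. R m v"
    and x: "x \<notin> fv B"
    and BA: "force w e (Impl B (Ex x A))"
  shows "force w e (Ex x (Impl B A))"
proof (cases "\<exists>v. R w v \<and> force v e B")
  case True
  then obtain m where m: "R w m" "force m e B" "\<And>v. R w v \<Longrightarrow> force v e B \<Longrightarrow> R m v"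
    using first[of "{v. R w v \<and> force v e B}"] by auto
  then obtain a where "a \<in> D w" "force m (e(x := a)) A"
    using BA const by auto
  then show ?thesis
    using m(3) force_mono by (simp add: force_upd_notin_fv[OF x]) blast
next
  case False
  have "F 0 [] \<in> D w" by (rule F_closed) simp
  then show ?thesis
    using False by (auto simp: force_upd_notin_fv[OF x])
qed

end

section \<open>The countermodels\<close>

lemma wellorder_ex_first: "S \<noteq> {} \<Longrightarrow> \<exists>m\<in>S. \<forall>v\<in>S. m \<le> (v :: 'a :: wellorder)"
  by (rule bexI[of _ "LEAST v. v \<in> S"]) (auto intro: Least_le LeastI)

lemma ED_not_derivable_from_CD_SW: "\<not> ED \<subseteq> IQC_plus (CD \<union> SW)"
proof
  assume sub: "ED \<subseteq> IQC_plus (CD \<union> SW)"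
  \<comment> \<open>The root is \<infinity>. A finite world \<open>w\<close> forces Q and has
    \<open>w\<close> itself as a witness for P, but no number bounds all finite worlds.\<close>
  define I :: "enat \<Rightarrow> nat \<Rightarrow> nat list \<Rightarrow> bool" where
    "I w p as = (if p = 0 then (\<forall>a\<in>set as. w \<le> enat a) else w \<noteq> \<infinity>)" for w p as
  interpret kripke "(\<ge>)" "\<lambda>_. UNIV" "\<lambda>_ _. 0" I
    by unfold_locales (auto simp: I_def split: if_splits intro: order_trans dest: enat_ile)
  let ?C = "Impl (Impl (Pred 1 []) (Ex 0 (Pred 0 [Var 0]))) (Ex 0 (Impl (Pred 1 []) (Pred 0 [Var 0])))"
  have "?C \<in> ED" unfolding ED_def by force
  then have "valid ?C"
    using sub soundness[of "CD \<union> SW"] CD_valid SW_valid[OF _ wellorder_ex_first] by blast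
  then have "force \<infinity> (\<lambda>_. 0) ?C"
    by (rule validD) simp
  moreover have "force \<infinity> (\<lambda>_. 0) (Impl (Pred 1 []) (Ex 0 (Pred 0 [Var 0])))"
    by (auto simp: I_def)
  ultimately obtain a where "force \<infinity> ((\<lambda>_. 0)(0 := a)) (Impl (Pred 1 []) (Pred 0 [Var 0]))"
    by (metis R_refl force.simps(5,7))
  then have "\<forall>v. v \<noteq> \<infinity> \<longrightarrow> v \<le> enat a"
    by (simp add: I_def)
  from this[rule_format, of "enat (Suc a)"] show False by simp
qed

lemma SW_not_derivable_from_CD_ED: "\<not> SW \<subseteq> IQC_plus (CD \<union> ED)"
proof
  assume sub: "SW \<subseteq> IQC_plus (CD \<union> ED)"
  \<comment> \<open>P(a) is forced from world \<open>a\<close> on, so no negation of P(a) is ever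
    forced, while P(w + 1) fails at \<open>w\<close>, so the universal formula is never
    forced.\<close>
  define I :: "nat \<Rightarrow> nat \<Rightarrow> nat list \<Rightarrow> bool" where "I w p as \<longleftrightarrow> (\<forall>a\<in>set as. a \<le> w)" for w p as
  interpret kripke "(\<le>)" "\<lambda>_. UNIV" "\<lambda>_ _. 0" I
    by unfold_locales (auto simp: I_def)
  have "valid C" if "C \<in> ED" for C
  proof (rule validI)
    fix w and e :: "nat \<Rightarrow> nat"
    obtain x A B where C: "C = Impl (Impl B (Ex x A)) (Ex x (Impl B A))" and x: "x \<notin> fv B"
      using \<open>C \<in> ED\<close> unfolding ED_def by blast
    show "force w e C"
      \<comment> \<open>Only the outer implication is unfolded, leaving the inner formulas in the
        form of \<open>force_ED\<close>.\<close>
      unfolding C force.simps(5)[of _ _ "Impl B (Ex x A)"]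
      using force_ED[OF _ wellorder_ex_first x] by blast
  qed
  moreover let ?C = "Impl (Impl (All 0 (Pred 0 [Var 0])) Falsum) (Ex 0 (Impl (Pred 0 [Var 0]) Falsum))"
  have "?C \<in> SW" unfolding SW_def by force
  ultimately have "valid ?C"
    using sub soundness[of "CD \<union> ED"] CD_valid by blast
  then have "force 0 (\<lambda>_. 0) ?C"
    by (rule validD) simp
  moreover have "force 0 (\<lambda>_. 0) (Impl (All 0 (Pred 0 [Var 0])) Falsum)"
    by (auto simp: I_def) (meson Suc_n_not_le_n le_refl)
  ultimately obtain a where "force 0 ((\<lambda>_. 0)(0 := a)) (Impl (Pred 0 [Var 0]) Falsum)"
    by (metis R_refl force.simps(5,7))
  then show False by (auto simp: I_def)
qed

section \<open>The growing-domain model of ED\<close>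

definition grow_dom :: "nat \<Rightarrow> nat set" where
  "grow_dom w = (if w = 0 then {0} else UNIV)"

definition grow_interp :: "nat \<Rightarrow> nat \<Rightarrow> nat list \<Rightarrow> bool" where
  "grow_interp w p as \<longleftrightarrow> (if p = 0 then \<forall>a\<in>set as. a \<le> w - 1 else w \<ge> 1)"

interpretation grow: kripke "(\<le>)" grow_dom "\<lambda>_ _. 0" grow_interp
proof
  show "grow_interp v p as" if "w \<le> v" "grow_interp w p as" for w v p as
    using that by (fastforce simp: grow_interp_def split: if_splits)
qed (auto simp: grow_dom_def)

lemma all_ge_add_iff: "(\<forall>v\<ge>w + k. Q v) \<longleftrightarrow> (\<forall>v\<ge>w. Q (v + k))" for w k :: nat
proof (intro iffI allI impI)
  fix v assume *: "\<forall>v\<ge>w. Q (v + k)" and v: "w + k \<le> v"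
  have "Q (v - k + k)" using v by (intro *[rule_format]) simp
  then show "Q v" using v by simp
qed simp

text \<open>The map \<open>a\<close> to \<open>a - k\<close> sends the naturals onto themselves and
  turns P at \<open>w + k\<close> into P at \<open>w\<close>; being onto, it respects both
  quantifiers. The bound on \<open>w\<close> keeps the exceptional root out.\<close>

lemma grow_force_shift:
  "w \<ge> 1 \<Longrightarrow> grow.force (w + k) e A \<longleftrightarrow> grow.force w (\<lambda>x. e x - k) A"
proof (induction A arbitrary: w e)
  case (Pred p ts)
  \<comment> \<open>Compound terms denote 0, which truncated subtraction fixes.\<close>
  have ev: "grow.eval (\<lambda>x. e x - k) t = grow.eval e t - k" for t
    by (cases t) auto
  have "a \<le> w + k - 1 \<longleftrightarrow> a - k \<le> w - 1" for a
    using Pred.prems by arith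
  then show ?case
    using Pred.prems by (simp only: grow.force.simps) (simp add: grow_interp_def ev)
next
  case (Impl A B)
  have "grow.force (v + k) e A = grow.force v (\<lambda>x. e x - k) A"
    "grow.force (v + k) e B = grow.force v (\<lambda>x. e x - k) B" if "v \<ge> w" for v
    using Impl.IH Impl.prems that by auto
  then show ?case by (simp only: grow.force.simps all_ge_add_iff) blast
next
  case (All x A)
  have upd: "(\<lambda>y. (e(x := a)) y - k) = (\<lambda>y. e y - k)(x := a - k)" for a
    by auto
  have "grow.force (v + k) (e(x := a)) A = grow.force v ((\<lambda>y. e y - k)(x := a - k)) A"
    if "v \<ge> w" for v a
    using All.IH[of v "e(x := a)"] All.prems that unfolding upd by linarith
  moreover have "grow_dom (v + k) = UNIV" "grow_dom v = UNIV" if "v \<ge> w" for v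
    using All.prems that by (auto simp: grow_dom_def)
  \<comment> \<open>Surjectivity: \<open>a\<close> is the image of \<open>a + k\<close>.\<close>
  moreover have "(\<forall>a. grow.force v ((\<lambda>y. e y - k)(x := a - k)) A) \<longleftrightarrow>
      (\<forall>a. grow.force v ((\<lambda>y. e y - k)(x := a)) A)" for v
    by (metis diff_add_inverse2)
  ultimately show ?case
    by (simp add: all_ge_add_iff del: fun_upd_apply)
next
  case (Ex x A)
  have upd: "(\<lambda>y. (e(x := a)) y - k) = (\<lambda>y. e y - k)(x := a - k)" for a
    by auto
  have "grow.force (w + k) (e(x := a)) A = grow.force w ((\<lambda>y. e y - k)(x := a - k)) A" for a
    using Ex.IH[of w "e(x := a)"] Ex.prems unfolding upd by linarith
  moreover have "grow_dom (w + k) = UNIV" "grow_dom w = UNIV"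
    using Ex.prems by (auto simp: grow_dom_def)
  moreover have "(\<exists>a. grow.force w ((\<lambda>y. e y - k)(x := a - k)) A) \<longleftrightarrow>
      (\<exists>a. grow.force w ((\<lambda>y. e y - k)(x := a)) A)"
    by (metis diff_add_inverse2)
  ultimately show ?case
    by (simp del: fun_upd_apply)
qed auto

text \<open>The witness has to be 0, so A(0) must hold wherever B does.\<close>

lemma grow_force_ED_root:
  assumes e: "e = (\<lambda>_. 0)"
    and BA: "grow.force 0 e (Impl B (Ex x A))"
  shows "grow.force 0 e (Ex x (Impl B A))"
proof -
  have e0: "e(x := 0) = e" using e by auto
  have BA': "grow.force v e (Ex x A)" if "grow.force v e B" for v
    using BA that by simp
  have "grow.force v e A" if v: "grow.force v e B" for v
  proof (cases "v = 0")
    case True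
    then show ?thesis using BA'[OF v] e0 by (simp add: grow_dom_def)
  next
    case False
    \<comment> \<open>The zero assignment is fixed by the shift, so B descends from \<open>v\<close>
      to world 1.\<close>
    then have "grow.force 1 e B"
      using v grow_force_shift[of 1 "v - 1" e B] e by simp
    then obtain a where "grow.force 1 (e(x := a)) A"
      using BA' grow.force.simps(7) by blast
    \<comment> \<open>Going up by exactly \<open>a\<close> lets the shift back turn the witness
      \<open>a\<close> into 0.\<close>
    then have "grow.force (1 + a) (e(x := a)) A"
      by (rule grow.force_mono[rotated]) simp
    then have "grow.force 1 (\<lambda>y. (e(x := a)) y - a) A"
      using grow_force_shift by blast
    moreover have "(\<lambda>y. (e(x := a)) y - a) = e"
      using e by auto
    ultimately have "grow.force 1 e A" by simp
    then show ?thesis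
      by (rule grow.force_mono[rotated]) (use False in simp)
  qed
  then show ?thesis using e0 by (simp add: grow_dom_def)
qed

lemma CD_not_derivable_from_ED: "\<not> CD \<subseteq> IQC_plus ED"
proof
  assume sub: "CD \<subseteq> IQC_plus ED"
  have "grow.valid C" if "C \<in> ED" for C
  proof (rule grow.validI)
    fix w and e :: "nat \<Rightarrow> nat" assume e: "range e \<subseteq> grow_dom w"
    obtain x A B where C: "C = Impl (Impl B (Ex x A)) (Ex x (Impl B A))" and x: "x \<notin> fv B"
      using \<open>C \<in> ED\<close> unfolding ED_def by blast
    have "grow.force v e (Ex x (Impl B A))"
      if "w \<le> v" and BA: "grow.force v e (Impl B (Ex x A))" for v
    proof (cases "v = 0")
      case True
      \<comment> \<open>Here \<open>w\<close> is the root too, whose domain is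
        \<open>{0}\<close>.\<close>
      then have "e = (\<lambda>_. 0)" using e that(1) by (auto simp: grow_dom_def)
      then show ?thesis using grow_force_ED_root BA True by blast
    next
      case False
      show ?thesis
        by (rule grow.force_ED[OF _ wellorder_ex_first x BA]) (use False in \<open>auto simp: grow_dom_def\<close>)
    qed
    then show "grow.force w e C"
      unfolding C grow.force.simps(5)[of _ _ "Impl B (Ex x A)"] by blast
  qed
  moreover let ?C = "Impl (All 0 (Disj (Pred 0 [Var 0]) (Pred 1 []))) (Disj (All 0 (Pred 0 [Var 0])) (Pred 1 []))"
  have "?C \<in> CD" unfolding CD_def by force
  ultimately have "grow.valid ?C"
    using sub grow.soundness by blast
  then have "grow.force 0 (\<lambda>_. 0) ?C"
    by (rule grow.validD) (simp add: grow_dom_def)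
  moreover have "grow.force 0 (\<lambda>_. 0) (All 0 (Disj (Pred 0 [Var 0]) (Pred 1 [])))"
    by (auto simp: grow_interp_def grow_dom_def)
  ultimately have "grow.force 0 (\<lambda>_. 0) (Disj (All 0 (Pred 0 [Var 0])) (Pred 1 []))"
    by (metis grow.R_refl grow.force.simps(5))
  then have "\<forall>v. \<forall>a\<in>grow_dom v. a \<le> v - 1"
    by (simp add: grow_interp_def)
  \<comment> \<open>The element 1 exists at world 1, but P(1) is forced only from world 2
    on.\<close>
  from this[rule_format, of 1 1] show False by (simp add: grow_dom_def)
qed

section \<open>Deriving CD from SW\<close>

lemma subst_Var_self: "subst x (Var x) A = A"
proof -
  have "tsubst x (Var x) t = t" for t
    by (induction t) (auto intro: map_idI)
  then show ?thesis
    by (induction A) (auto intro: map_idI)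
qed

lemma free_for_Var_self: "free_for (Var x) x A"
  by (induction A) auto

lemma IQC_plus_allE: "Impl (All x A) A \<in> IQC_plus X"
  using iqc_ax[OF ax_allE[OF free_for_Var_self]] subst_Var_self by simp

lemma IQC_plus_weaken: "A \<in> IQC_plus X \<Longrightarrow> Impl B A \<in> IQC_plus X"
  using iqc_mp[OF iqc_ax[OF ax_implK]] .

lemma IQC_plus_mp_under:
  "Impl A (Impl B C) \<in> IQC_plus X \<Longrightarrow> Impl A B \<in> IQC_plus X \<Longrightarrow> Impl A C \<in> IQC_plus X"
  using iqc_mp[OF iqc_mp[OF iqc_ax[OF ax_implS]]] .

lemma IQC_plus_impl_trans:
  "Impl A B \<in> IQC_plus X \<Longrightarrow> Impl B C \<in> IQC_plus X \<Longrightarrow> Impl A C \<in> IQC_plus X"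
  using IQC_plus_mp_under IQC_plus_weaken by blast

lemma CD_derivable_from_SW: "CD \<subseteq> IQC_plus SW"
proof
  fix G assume "G \<in> CD"
  then obtain x A B where G: "G = Impl (All x (Disj A B)) (Disj (All x A) B)" and x: "x \<notin> fv B"
    unfolding CD_def by blast
  define C where "C = Disj (All x A) B"
  let ?H = "All x (Disj A B)"
  have xC: "x \<notin> fv C" using x by (simp add: C_def)
  have "Impl (Impl (All x A) C) (Ex x (Impl A C)) \<in> IQC_plus SW"
    using xC unfolding SW_def by (intro iqc_inst) blast
  then have ex: "Ex x (Impl A C) \<in> IQC_plus SW"
    by (rule iqc_mp) (unfold C_def, rule iqc_ax[OF ax_disjI1])
  have "Impl B C \<in> IQC_plus SW"
    unfolding C_def by (rule iqc_ax[OF ax_disjI2])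
  \<comment> \<open>Case distinction with the B case already discharged.\<close>
  then have "Impl (Impl A C) (Impl (Disj A B) C) \<in> IQC_plus SW"
    using IQC_plus_mp_under[OF iqc_ax[OF ax_disjE] IQC_plus_weaken] by blast
  moreover have "Impl (Impl (Disj A B) C) (Impl ?H C) \<in> IQC_plus SW"
    using IQC_plus_mp_under[OF IQC_plus_impl_trans[OF iqc_ax[OF ax_implK] iqc_ax[OF ax_implS]]
        IQC_plus_weaken[OF IQC_plus_allE]] .
  ultimately have "Impl (Impl A C) (Impl ?H C) \<in> IQC_plus SW"
    by (rule IQC_plus_impl_trans)
  \<comment> \<open>\<open>x\<close> is bound in \<open>?H\<close> and not free in \<open>C\<close>,
    so the witness can be eliminated.\<close>
  then have "Impl (Ex x (Impl A C)) (Impl ?H C) \<in> IQC_plus SW"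
    by (rule iqc_exR) (use xC in simp)
  then show "G \<in> IQC_plus SW"
    using ex iqc_mp unfolding G C_def by blast
qed

theorem mainTheorem10:
  "\<not> ED \<subseteq> IQC_plus (CD \<union> SW) \<and>
   \<not> SW \<subseteq> IQC_plus (CD \<union> ED) \<and>
   CD \<subseteq> IQC_plus SW \<and>
   \<not> CD \<subseteq> IQC_plus ED"
  using ED_not_derivable_from_CD_SW SW_not_derivable_from_CD_ED CD_derivable_from_SW
    CD_not_derivable_from_ED by blast

end
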